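(* Let $A,B\in\mathcal{CQT}$, where $A=T(a)+E_a$ and $B=T(b)+E_b$ with $a,b\in\mathcal W_1$ and $E_a,E_b\in\mathcal F$. Then $C=AB=T(c)+E_c\in\mathcal{CQT}$ with $c(z)=a(z)b(z)$. Moreover, $$\|E_c\|_{\mathcal F}\le \|H(a^-)\|_{\mathcal F}\,\|H(b^+)\|_{\mathcal F}+\|a\|_{\mathcal W}\|E_b\|_{\mathcal F}+\|b\|_{\mathcal W}\|E_a\|_{\mathcal F}+\|E_a\|_{\mathcal F}\,\|E_b\|_{\mathcal F}.$$
   Context: $\mathbb T=\{z\in\mathbb C: |z|=1\}$ and $\mathbb Z^+$ is the set of positive integers. The Wiener class $\mathcal W$ is the set of functions $a(z)=\sum_{i\in\mathbb Z}a_iz^i:\mathbb T\to\mathbb C$ with $\|a\|_{\mathcal W}:=\sum_{i\in\mathbb Z}|a_i|<\infty$. $\mathcal W_1$ is the set of $a\in\mathcal W$ that are continuous and such that $a'(z)=\sum_{i\in\mathbb Z}ia_iz^{i-1}\in\mathcal W$. For $a(z)=\sum_{i\in\mathbb Z}a_iz^i$ set $a^+(z)=\sum_{i\in\mathbb Z^+}a_iz^i$ and $a^-(z)=\sum_{i\in\mathbb Z^+}a_{-i}z^i$. For $a\in\mathcal W$, $T(a)=(t_{i,j})_{i,j\in\mathbb Z^+}$ is the semi-infinite Toeplitz matrix with $t_{i,j}=a_{j-i}$. For a power series $b(z)=\sum_{i\ge0}b_iz^i$, $H(b)=(h_{i,j})_{i,j\in\mathbb Z^+}$ is the semi-infinite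 Hankel matrix with $h_{i,j}=b_{i+j-1}$. $\mathcal F$ is the set of semi-infinite complex matrices $F=(f_{i,j})_{i,j\in\mathbb Z^+}$ with $\|F\|_{\mathcal F}:=\sum_{i,j\in\mathbb Z^+}|f_{i,j}|<\infty$. $\mathcal{CQT}$ is the set of semi-infinite matrices of the form $T(a)+E$ with $a\in\mathcal W_1$ and $E\in\mathcal F$ (this decomposition is unique). Products of semi-infinite matrices are rows-by-columns products. *)

theory Defs
  imports "HOL-Complex_Analysis.Complex_Analysis"
begin

text \<open>
  A function on the unit circle is a function \<open>complex \<Rightarrow> complex\<close> of which only the values on
  \<open>unit_circle\<close> matter.
\<close>

abbreviation unit_circle :: "complex set" where
  "unit_circle \<equiv> sphere 0 1"

definition wiener_expansion :: "(complex \<Rightarrow> complex) \<Rightarrow> (int \<Rightarrow> complex) \<Rightarrow> bool" where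
  "wiener_expansion a s \<longleftrightarrow>
     (\<lambda>i. norm (s i)) summable_on UNIV \<and>
     (\<forall>z\<in>unit_circle. ((\<lambda>i. s i * z powi i) has_sum a z) UNIV)"

definition wiener :: "(complex \<Rightarrow> complex) set" where
  "wiener = {a. \<exists>s. wiener_expansion a s}"

text \<open>Meaningful for \<open>a \<in> wiener\<close> only; well defined there by \<open>wiener_expansion_unique\<close> below.\<close>

definition laurent_coeff :: "(complex \<Rightarrow> complex) \<Rightarrow> int \<Rightarrow> complex" where
  "laurent_coeff a = (THE s. wiener_expansion a s)"

definition wiener_norm :: "(complex \<Rightarrow> complex) \<Rightarrow> real" where
  "wiener_norm a = (\<Sum>\<^sub>\<infinity>i. norm (laurent_coeff a i))"

text \<open>
  The function \<open>d\<close> is the formal derivative. It is required to be the sum of its series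
  (rather than being defined by \<open>infsum\<close>, which is 0 for a divergent series).
\<close>

definition wiener1 :: "(complex \<Rightarrow> complex) set" where
  "wiener1 = {a \<in> wiener. continuous_on unit_circle a \<and>
     (\<exists>d\<in>wiener. \<forall>z\<in>unit_circle.
        ((\<lambda>i. of_int i * laurent_coeff a i * z powi (i - 1)) has_sum d z) UNIV)}"

definition plus_part :: "(complex \<Rightarrow> complex) \<Rightarrow> complex fps" where
  "plus_part a = Abs_fps (\<lambda>i. if i = 0 then 0 else laurent_coeff a (int i))"

definition minus_part :: "(complex \<Rightarrow> complex) \<Rightarrow> complex fps" where
  "minus_part a = Abs_fps (\<lambda>i. if i = 0 then 0 else laurent_coeff a (- int i))"

text \<open>
  Semi-infinite matrices are indexed from 0: the entry at \<open>i\<close>, \<open>j\<close> is the entry at the positive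
  integers \<open>i + 1\<close>, \<open>j + 1\<close> in the usual convention. Hence the Hankel entry
  \<open>b\<^bsub>(i+1)+(j+1)-1\<^esub>\<close> is the coefficient with index \<open>i + j + 1\<close>.
\<close>

type_synonym inf_matrix = "nat \<Rightarrow> nat \<Rightarrow> complex"

definition toeplitz :: "(complex \<Rightarrow> complex) \<Rightarrow> inf_matrix" where
  "toeplitz a = (\<lambda>i j. laurent_coeff a (int j - int i))"

definition hankel :: "complex fps \<Rightarrow> inf_matrix" where
  "hankel b = (\<lambda>i j. fps_nth b (i + j + 1))"

definition mat_add :: "inf_matrix \<Rightarrow> inf_matrix \<Rightarrow> inf_matrix" where
  "mat_add A B = (\<lambda>i j. A i j + B i j)"

text \<open>
  \<open>is_mat_prod A B C\<close>: all the series in the rows-by-columns product of \<open>A\<close> and \<open>B\<close> converge,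
  and the product is \<open>C\<close>.
\<close>

definition is_mat_prod :: "inf_matrix \<Rightarrow> inf_matrix \<Rightarrow> inf_matrix \<Rightarrow> bool" where
  "is_mat_prod A B C \<longleftrightarrow> (\<forall>i j. ((\<lambda>k. A i k * B k j) has_sum C i j) UNIV)"

definition F_class :: "inf_matrix set" where
  "F_class = {F. (\<lambda>(i, j). norm (F i j)) summable_on UNIV}"

definition F_norm :: "inf_matrix \<Rightarrow> real" where
  "F_norm F = (\<Sum>\<^sub>\<infinity>(i, j). norm (F i j))"

definition CQT :: "inf_matrix set" where
  "CQT = {mat_add (toeplitz a) E | a E. a \<in> wiener1 \<and> E \<in> F_class}"

lemma power_int_contour_integral:
  "((\<lambda>z::complex. z powi k) has_contour_integral (if k = -1 then 2 * pi * \<i> else 0))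
     (circlepath 0 1)"
proof (cases "k = -1")
  case True
  have "((\<lambda>z. 1 / (z - 0)) has_contour_integral 2 * pi * \<i>) (circlepath (0::complex) 1)"
    using Cauchy_integral_circlepath_simple[of "\<lambda>_. 1" 0 1 0] by simp
  then show ?thesis using True by (simp add: power_int_minus inverse_eq_divide)
next
  case False
  then have k: "(of_int (k + 1) :: complex) \<noteq> 0"
    unfolding of_int_eq_0_iff by linarith
  have "((\<lambda>z::complex. z powi k) has_contour_integral 0) (circlepath 0 1)"
  proof (rule Cauchy_theorem_primitive[where S = "- {0}"
        and f = "\<lambda>z. z powi (k + 1) / of_int (k + 1)"])
    show "((\<lambda>z. z powi (k + 1) / of_int (k + 1)) has_field_derivative x powi k) (at x within - {0})"
      if "x \<in> - {0}" for x :: complex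
      using that k by (auto intro!: derivative_eq_intros)
  qed auto
  then show ?thesis using False by simp
qed

lemma zero_expansion_coeff:
  assumes abs: "(\<lambda>i. norm (d i)) summable_on UNIV"
    and sum: "\<And>z. z \<in> unit_circle \<Longrightarrow> ((\<lambda>i. d i * z powi i) has_sum 0) UNIV"
  shows "d n = 0"
proof -
  have bound: "norm (d n) \<le> e" if e: "e > 0" for e
  proof -
    obtain S where S: "((\<lambda>i. norm (d i)) has_sum S) UNIV"
      using abs by (auto simp: summable_on_def)
    obtain X where X: "finite X" "\<And>Y. finite Y \<Longrightarrow> X \<subseteq> Y \<Longrightarrow> dist (\<Sum>i\<in>Y. norm (d i)) S < e"
      using tendstoD[OF S[unfolded has_sum_def] e]
      by (auto simp: eventually_finite_subsets_at_top)
    define Y where "Y = insert n X"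
    have Y: "finite Y" "n \<in> Y" "dist (\<Sum>i\<in>Y. norm (d i)) S < e"
      using X by (auto simp: Y_def)
    have tail: "((\<lambda>i. norm (d i)) has_sum (S - (\<Sum>i\<in>Y. norm (d i)))) (- Y)"
      using has_sum_Diff[OF S has_sum_finite[OF Y(1)]] by (simp add: Compl_eq_Diff_UNIV)
    define g where "g = (\<lambda>z. \<Sum>i\<in>Y. d i * z powi (i - n - 1))"
    have "(g has_contour_integral (\<Sum>i\<in>Y. d i * (if i - n - 1 = -1 then 2 * pi * \<i> else 0)))
            (circlepath 0 1)"
      unfolding g_def
      by (intro has_contour_integral_sum has_contour_integral_lmul power_int_contour_integral Y(1))
    also have "(\<Sum>i\<in>Y. d i * (if i - n - 1 = -1 then 2 * pi * \<i> else 0)) = d n * (2 * pi * \<i>)"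
      using Y by (simp add: if_distrib cong: if_cong)
    finally have int: "(g has_contour_integral d n * (2 * pi * \<i>)) (circlepath 0 1)" .
    have gbound: "norm (g z) \<le> e" if z: "norm (z - 0) = 1" for z
    proof -
      have nz: "z \<noteq> 0" using z by auto
      have "((\<lambda>i. d i * z powi i) has_sum (0 - (\<Sum>i\<in>Y. d i * z powi i))) (- Y)"
        using has_sum_Diff[OF sum[of z] has_sum_finite[OF Y(1)]] z
        by (simp add: Compl_eq_Diff_UNIV)
      then have "norm (0 - (\<Sum>i\<in>Y. d i * z powi i)) \<le> S - (\<Sum>i\<in>Y. norm (d i))"
        by (rule norm_has_sum_bound[rotated])
           (use tail z in \<open>simp add: norm_mult norm_power_int\<close>)
      then have *: "norm (\<Sum>i\<in>Y. d i * z powi i) \<le> e"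
        using Y(3) by (simp add: dist_real_def)
      have pw: "z powi (i - n - 1) = z powi i * z powi (- n - 1)" for i
        using power_int_add[of z i "- n - 1", OF disjI1[OF nz]]
        by (simp only: add_diff_eq add_uminus_conv_diff)
      have "g z = (\<Sum>i\<in>Y. d i * z powi i) * z powi (- n - 1)"
        unfolding g_def sum_distrib_right pw by (simp only: mult.assoc)
      then show ?thesis using * z by (simp add: norm_mult norm_power_int)
    qed
    have "norm (d n * (2 * pi * \<i>)) \<le> e * (2 * pi * 1)"
      using has_contour_integral_bound_circlepath[OF int _ _ gbound] e by simp
    then have "norm (d n) * (2 * pi) \<le> e * (2 * pi)"
      by (simp only: norm_mult norm_ii norm_of_real) simp
    then show ?thesis by (rule mult_right_le_imp_le) simp
  qed
  have "norm (d n) \<le> 0" by (rule field_le_epsilon) (simp add: bound)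
  then show ?thesis by simp
qed

lemma wiener_expansion_unique:
  assumes "wiener_expansion a s" "wiener_expansion a t"
  shows "s = t"
proof
  fix n
  have "s n - t n = 0"
  proof (rule zero_expansion_coeff[where d = "\<lambda>i. s i - t i"])
    have "s summable_on UNIV" "t summable_on UNIV"
      using assms by (auto simp: wiener_expansion_def abs_summable_summable)
    then show "(\<lambda>i. norm (s i - t i)) summable_on UNIV"
      using summable_on_add[of s UNIV "\<lambda>i. - t i"]
      unfolding summable_on_uminus summable_on_iff_abs_summable_on_complex[symmetric] by simp
    show "((\<lambda>i. (s i - t i) * z powi i) has_sum 0) UNIV" if "z \<in> unit_circle" for z
    proof -
      have "((\<lambda>i. s i * z powi i + - (t i * z powi i)) has_sum (a z + - a z)) UNIV"
        using assms that unfolding wiener_expansion_def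
        by (intro has_sum_add has_sum_uminus[THEN iffD2]) simp_all
      then show ?thesis by (simp add: left_diff_distrib)
    qed
  qed
  then show "s n = t n" by simp
qed

lemma laurent_coeff_eq: "wiener_expansion a s \<Longrightarrow> laurent_coeff a = s"
  unfolding laurent_coeff_def by (blast intro: the_equality wiener_expansion_unique)

end

theory Submission
  imports Defs
begin

text \<open>
  Entry \<open>(i, j)\<close> of \<open>T(a) T(b)\<close> is the sum of \<open>a\<^bsub>l-i\<^esub> b\<^bsub>j-l\<^esub>\<close> over \<open>l \<ge> 0\<close>, a truncation of the
  convolution series over all integers \<open>l\<close>, whose value is the coefficient of \<open>a b\<close> with index
  \<open>j - i\<close>. The missing terms \<open>l = -1-k\<close> with \<open>k \<ge> 0\<close> are
  \<open>a\<^bsub>-(i+k+1)\<^esub> b\<^bsub>k+j+1\<^esub>\<close>, and their sum is entry \<open>(i, j)\<close> of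
  \<open>H(a\<^sup>-) H(b\<^sup>+)\<close>. So \<open>T(a) T(b) = T(a b) - H(a\<^sup>-) H(b\<^sup>+)\<close> (lemma \<open>toeplitz_mult\<close>), and expanding
  the product of the two perturbed matrices gives
  \<open>E\<^sub>c = T(a) E\<^sub>b + E\<^sub>a T(b) + E\<^sub>a E\<^sub>b - H(a\<^sup>-) H(b\<^sup>+)\<close>, one term for each summand of the bound.

  The convergence of all the products involved and their norm bounds come from one principle,
  \<open>reindexed_product\<close>: if \<open>f\<close> and \<open>g\<close> are absolutely summable, then so is any family of
  products \<open>f x * g y\<close> in which no pair \<open>(x, y)\<close> occurs twice, and the norms of its terms add up
  to at most the product of the two norms. For matrix products the family is indexed by the
  triples \<open>((i, j), k)\<close>. A Toeplitz factor stores the same coefficient in infinitely many entries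
  but still contributes only its Wiener norm: in \<open>T(a) E\<close> the triple is recovered from \<open>k - i\<close> and
  the position \<open>(k, j)\<close> in \<open>E\<close>.

  The derivative conditions matter twice. At \<open>z = 1\<close> they say that \<open>i a\<^sub>i\<close> is absolutely summable,
  which is what puts the Hankel matrices into \<open>F_class\<close>; and the Leibniz rule for convolutions carries
  them over to \<open>a b\<close>.
\<close>

(* Absolute summability means summable_on for the norms, not integrability for the counting measure. *)
no_notation Infinite_Set_Sum.abs_summable_on (infix "abs'_summable'_on" 50)

section \<open>Sums of products along an injective reindexing\<close>

lemma abs_summable_tensor:
  fixes f :: "'x \<Rightarrow> complex" and g :: "'y \<Rightarrow> complex"
  assumes "f abs_summable_on UNIV" and "g abs_summable_on UNIV"
  shows "(\<lambda>(x, y). f x * g y) abs_summable_on UNIV"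
    and "(\<Sum>\<^sub>\<infinity>(x, y). norm (f x * g y)) = (\<Sum>\<^sub>\<infinity>x. norm (f x)) * (\<Sum>\<^sub>\<infinity>y. norm (g y))"
    and "(\<Sum>\<^sub>\<infinity>(x, y). f x * g y) = infsum f UNIV * infsum g UNIV"
proof -
  have "(\<lambda>(x, y). f x * g y) abs_summable_on UNIV \<times> UNIV"
    unfolding Infinite_Sum.abs_summable_on_Sigma_iff
    using assms by (auto simp: norm_mult infsum_cmult_right' abs_mult infsum_nonneg
        intro!: summable_on_cmult_right summable_on_cmult_left)
  then show *: "(\<lambda>(x, y). f x * g y) abs_summable_on UNIV"
    by simp
  then have "(\<lambda>(x, y). norm (f x * g y)) summable_on UNIV \<times> UNIV"
    by (simp add: case_prod_unfold)
  from infsum_Sigma'_banach[OF this]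
  show "(\<Sum>\<^sub>\<infinity>(x, y). norm (f x * g y)) = (\<Sum>\<^sub>\<infinity>x. norm (f x)) * (\<Sum>\<^sub>\<infinity>y. norm (g y))"
    by (simp add: norm_mult infsum_cmult_right' infsum_cmult_left')
  have "(\<lambda>(x, y). f x * g y) summable_on UNIV \<times> UNIV"
    using abs_summable_summable[OF *] by simp
  from infsum_Sigma'_banach[OF this]
  show "(\<Sum>\<^sub>\<infinity>(x, y). f x * g y) = infsum f UNIV * infsum g UNIV"
    by (simp add: infsum_cmult_right' infsum_cmult_left')
qed

text \<open>
  The terms are a subfamily of the tensor product of \<open>f\<close> and \<open>g\<close>, which gives summability and the
  bound. If the reindexing is also onto, they are the whole tensor product, so that summing first
  over \<open>k\<close> and then over \<open>m\<close> yields the product of the two sums.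
\<close>

lemma reindexed_product:
  fixes f :: "'x \<Rightarrow> complex" and g :: "'y \<Rightarrow> complex"
    and \<alpha> :: "'m \<Rightarrow> 'k \<Rightarrow> 'x" and \<beta> :: "'m \<Rightarrow> 'k \<Rightarrow> 'y"
  assumes "f abs_summable_on UNIV" and "g abs_summable_on UNIV"
    and inj: "inj (\<lambda>(m, k). (\<alpha> m k, \<beta> m k))"
  defines "P \<equiv> \<lambda>m k. f (\<alpha> m k) * g (\<beta> m k)"
  shows "P m abs_summable_on UNIV"
    and "(\<lambda>m. infsum (P m) UNIV) abs_summable_on UNIV"
    and "(\<Sum>\<^sub>\<infinity>m. norm (infsum (P m) UNIV)) \<le> (\<Sum>\<^sub>\<infinity>x. norm (f x)) * (\<Sum>\<^sub>\<infinity>y. norm (g y))"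
    and "surj (\<lambda>(m, k). (\<alpha> m k, \<beta> m k)) \<Longrightarrow>
           ((\<lambda>m. infsum (P m) UNIV) has_sum infsum f UNIV * infsum g UNIV) UNIV"
proof -
  define h where "h = (\<lambda>(m, k). (\<alpha> m k, \<beta> m k))"
  define G where "G = (\<lambda>(x, y). f x * g y)"
  have G: "G abs_summable_on UNIV"
    unfolding G_def by (rule abs_summable_tensor(1)) fact+
  have PG: "case_prod P = G \<circ> h"
    by (auto simp: P_def G_def h_def)
  have h: "inj h" using inj by (simp add: h_def)
  have "(\<lambda>x. norm (G x)) summable_on range h"
    by (rule summable_on_subset_banach[OF G]) simp
  then have P: "case_prod P abs_summable_on UNIV"
    using summable_on_reindex[OF h, of "\<lambda>x. norm (G x)"] by (simp add: PG o_def)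
  then have P': "case_prod P abs_summable_on UNIV \<times> UNIV"
    by simp
  have Pm: "P m abs_summable_on UNIV" for m
    using P' unfolding Infinite_Sum.abs_summable_on_Sigma_iff by simp
  show "P m abs_summable_on UNIV" by (rule Pm)
  have PP: "(\<lambda>(m, k). norm (P m k)) summable_on UNIV \<times> UNIV"
    using P by (simp add: case_prod_unfold)
  have Q: "(\<lambda>m. \<Sum>\<^sub>\<infinity>k. norm (P m k)) summable_on UNIV"
    by (rule summable_on_Sigma_banach[OF PP])
  have le: "norm (infsum (P m) UNIV) \<le> (\<Sum>\<^sub>\<infinity>k. norm (P m k))" for m
    by (rule norm_infsum_bound[OF Pm])
  show S: "(\<lambda>m. infsum (P m) UNIV) abs_summable_on UNIV"
    by (rule summable_on_comparison_test[OF Q]) (auto simp: le)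
  have "(\<Sum>\<^sub>\<infinity>m. norm (infsum (P m) UNIV)) \<le> (\<Sum>\<^sub>\<infinity>m. \<Sum>\<^sub>\<infinity>k. norm (P m k))"
    by (rule infsum_mono[OF S Q]) (rule le)
  also have "\<dots> = (\<Sum>\<^sub>\<infinity>p. norm (G (h p)))"
    unfolding infsum_Sigma'_banach[OF PP] using PG
    by (auto simp: fun_eq_iff intro!: infsum_cong)
  also have "\<dots> = (\<Sum>\<^sub>\<infinity>x\<in>range h. norm (G x))"
    by (simp add: infsum_reindex[OF h] o_def)
  also have "\<dots> \<le> (\<Sum>\<^sub>\<infinity>x. norm (G x))"
    by (rule infsum_mono_neutral) (auto intro: summable_on_subset_banach[OF G] G)
  also have "\<dots> = (\<Sum>\<^sub>\<infinity>x. norm (f x)) * (\<Sum>\<^sub>\<infinity>y. norm (g y))"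
    using abs_summable_tensor(2)[OF assms(1,2)] by (simp add: G_def case_prod_unfold)
  finally show "(\<Sum>\<^sub>\<infinity>m. norm (infsum (P m) UNIV)) \<le> \<dots>" .
  assume "surj (\<lambda>(m, k). (\<alpha> m k, \<beta> m k))"
  then have r: "range h = UNIV" by (simp add: h_def)
  have "(G has_sum infsum f UNIV * infsum g UNIV) (range h)"
    using has_sum_infsum[OF abs_summable_summable[OF G]] abs_summable_tensor(3)[OF assms(1,2)]
    by (simp add: r G_def)
  then have "(case_prod P has_sum infsum f UNIV * infsum g UNIV) (UNIV \<times> UNIV)"
    using has_sum_reindex[OF h, of G] by (simp add: PG)
  then show "((\<lambda>m. infsum (P m) UNIV) has_sum infsum f UNIV * infsum g UNIV) UNIV"
    by (rule has_sum_SigmaD) (use Pm in \<open>simp add: abs_summable_summable\<close>)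
qed

section \<open>Coefficients of a product\<close>

definition convolution :: "(int \<Rightarrow> complex) \<Rightarrow> (int \<Rightarrow> complex) \<Rightarrow> int \<Rightarrow> complex" where
  "convolution s t n = (\<Sum>\<^sub>\<infinity>k. s k * t (n - k))"

lemma inj_convolution_index: "inj (\<lambda>(n, k). (k, n - k :: int))"
  by (auto simp: inj_def)

lemma surj_convolution_index: "surj (\<lambda>(n, k). (k, n - k :: int))"
  by (rule surjI[where f = "\<lambda>(x, y). (x + y, x)"]) auto

lemma convolution_terms_summable:
  fixes s t :: "int \<Rightarrow> complex"
  assumes "s abs_summable_on UNIV" and "t abs_summable_on UNIV"
  shows "(\<lambda>k. s k * t (n - k)) summable_on UNIV"
  using reindexed_product(1)[OF assms inj_convolution_index] by (rule abs_summable_summable)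

lemma convolution_abs_summable:
  assumes "s abs_summable_on UNIV" and "t abs_summable_on UNIV"
  shows "convolution s t abs_summable_on UNIV"
  using reindexed_product(2)[OF assms inj_convolution_index]
  by (simp add: convolution_def[abs_def])

text \<open>
  The product rule on coefficients: split the factor \<open>n\<close> as \<open>k + (n - k)\<close> inside the series.
\<close>

lemma convolution_leibniz:
  assumes s: "s abs_summable_on UNIV" and t: "t abs_summable_on UNIV"
    and s': "(\<lambda>i. of_int i * s i) abs_summable_on UNIV"
    and t': "(\<lambda>i. of_int i * t i) abs_summable_on UNIV"
  shows "of_int n * convolution s t n
           = convolution (\<lambda>i. of_int i * s i) t n + convolution s (\<lambda>i. of_int i * t i) n"
proof -
  have "of_int n * convolution s t n
          = (\<Sum>\<^sub>\<infinity>k. of_int k * s k * t (n - k) + s k * (of_int (n - k) * t (n - k)))"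
    unfolding convolution_def infsum_cmult_right'[symmetric]
    by (rule infsum_cong) (simp add: algebra_simps)
  also have "\<dots> = convolution (\<lambda>i. of_int i * s i) t n + convolution s (\<lambda>i. of_int i * t i) n"
    unfolding convolution_def
    by (intro infsum_add convolution_terms_summable[OF s' t] convolution_terms_summable[OF s t'])
  finally show ?thesis .
qed

text \<open>
  On the unit circle \<open>z\<^sup>n = z\<^sup>k z\<^bsup>n-k\<^esup>\<close>, so the \<open>n\<close>-th term of the series collects the pairs of
  terms of the two factors whose exponents add up to \<open>n\<close>.
\<close>

lemma wiener_expansion_mult:
  assumes a: "wiener_expansion a s" and b: "wiener_expansion b t"
    and c: "\<And>z. z \<in> unit_circle \<Longrightarrow> c z = a z * b z"
  shows "wiener_expansion c (convolution s t)"
  unfolding wiener_expansion_def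
proof (intro conjI ballI)
  show "(\<lambda>i. norm (convolution s t i)) summable_on UNIV"
    using a b by (intro convolution_abs_summable) (auto simp: wiener_expansion_def)
  fix z assume z: "z \<in> unit_circle"
  then have nz: "z \<noteq> 0" and nrm: "norm z = 1" by auto
  define f where "f = (\<lambda>i. s i * z powi i)"
  define g where "g = (\<lambda>i. t i * z powi i)"
  have sums: "(f has_sum a z) UNIV" "(g has_sum b z) UNIV"
    using a b z by (auto simp: wiener_expansion_def f_def g_def)
  have abs: "f abs_summable_on UNIV" "g abs_summable_on UNIV"
    using a b nrm by (auto simp: wiener_expansion_def f_def g_def norm_mult norm_power_int)
  have "((\<lambda>n. \<Sum>\<^sub>\<infinity>k. f k * g (n - k)) has_sum infsum f UNIV * infsum g UNIV) UNIV"
    by (rule reindexed_product(4)[OF abs inj_convolution_index surj_convolution_index])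
  moreover have "(\<Sum>\<^sub>\<infinity>k. f k * g (n - k)) = convolution s t n * z powi n" for n
  proof -
    have "f k * g (n - k) = s k * t (n - k) * z powi n" for k
      using power_int_add[of z k "n - k"] nz by (simp add: f_def g_def)
    then show ?thesis by (simp add: convolution_def infsum_cmult_left')
  qed
  ultimately show "((\<lambda>i. convolution s t i * z powi i) has_sum c z) UNIV"
    using sums c[OF z] by (simp add: infsumI)
qed

text \<open>
  Convergence of the derivative series at the single point \<open>z = 1\<close> is enough, because unordered
  convergence of a complex series is absolute.
\<close>

lemma wiener1_weighted_summable:
  assumes "a \<in> wiener1"
  shows "wiener_expansion a (laurent_coeff a)"
    and "(\<lambda>i. of_int i * laurent_coeff a i) abs_summable_on UNIV"
proof -
  obtain s where "wiener_expansion a s"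
    using assms by (auto simp: wiener1_def wiener_def)
  then show "wiener_expansion a (laurent_coeff a)"
    using laurent_coeff_eq by metis
  obtain d where "\<forall>z\<in>unit_circle.
      ((\<lambda>i. of_int i * laurent_coeff a i * z powi (i - 1)) has_sum d z) UNIV"
    using assms by (auto simp: wiener1_def)
  from this[rule_format, of 1]
  have "(\<lambda>i. of_int i * laurent_coeff a i) summable_on UNIV"
    by (auto simp: summable_on_def)
  then show "(\<lambda>i. of_int i * laurent_coeff a i) abs_summable_on UNIV"
    by (simp only: summable_on_iff_abs_summable_on_complex)
qed

lemma wiener1I:
  assumes exp: "wiener_expansion c s" and cont: "continuous_on unit_circle c"
    and w: "(\<lambda>i. of_int i * s i) abs_summable_on UNIV"
  shows "c \<in> wiener1"
proof -
  \<comment> \<open>The coefficients of the derivative: the exponent drops by one.\<close>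
  define u where "u = (\<lambda>i. of_int (i + 1) * s (i + 1))"
  define d where "d = (\<lambda>z. \<Sum>\<^sub>\<infinity>i. u i * z powi i)"
  have bij: "bij (\<lambda>i::int. i - 1)"
    by (rule bij_betw_byWitness[where f' = "\<lambda>i. i + 1"]) auto
  have u: "u abs_summable_on UNIV"
    using summable_on_reindex_bij_betw[OF bij, of "\<lambda>i. norm (u i)"] w by (simp add: u_def)
  have d: "((\<lambda>i. u i * z powi i) has_sum d z) UNIV" if "z \<in> unit_circle" for z
  proof -
    have "(\<lambda>i. u i * z powi i) abs_summable_on UNIV"
      using u that by (simp add: norm_mult norm_power_int)
    then show ?thesis
      unfolding d_def by (rule has_sum_infsum[OF abs_summable_summable])
  qed
  have "wiener_expansion d u"
    using u d by (simp add: wiener_expansion_def)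
  then have "d \<in> wiener" by (auto simp: wiener_def)
  moreover have "((\<lambda>i. of_int i * laurent_coeff c i * z powi (i - 1)) has_sum d z) UNIV"
    if "z \<in> unit_circle" for z
    using has_sum_reindex_bij_betw[OF bij, of "\<lambda>i. u i * z powi i" "d z"] d[OF that]
    by (simp add: u_def laurent_coeff_eq[OF exp])
  ultimately show ?thesis
    using exp cont by (auto simp: wiener1_def wiener_def)
qed

lemma wiener1_mult:
  assumes a: "a \<in> wiener1" and b: "b \<in> wiener1"
    and c: "\<And>z. z \<in> unit_circle \<Longrightarrow> c z = a z * b z"
  shows "c \<in> wiener1"
    and "laurent_coeff c = convolution (laurent_coeff a) (laurent_coeff b)"
proof -
  note a' = wiener1_weighted_summable[OF a] and b' = wiener1_weighted_summable[OF b]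
  have exp: "wiener_expansion c (convolution (laurent_coeff a) (laurent_coeff b))"
    by (rule wiener_expansion_mult[OF a'(1) b'(1) c])
  then show "laurent_coeff c = convolution (laurent_coeff a) (laurent_coeff b)"
    by (rule laurent_coeff_eq)
  have sa: "laurent_coeff a abs_summable_on UNIV" and sb: "laurent_coeff b abs_summable_on UNIV"
    using a'(1) b'(1) by (auto simp: wiener_expansion_def)
  show "c \<in> wiener1"
  proof (rule wiener1I[OF exp])
    have "continuous_on unit_circle (\<lambda>z. a z * b z)"
      using a b by (auto simp: wiener1_def intro!: continuous_on_mult)
    then show "continuous_on unit_circle c"
      by (subst continuous_on_cong[OF refl c])
    have "(\<lambda>i. convolution (\<lambda>i. of_int i * laurent_coeff a i) (laurent_coeff b) i
             + convolution (laurent_coeff a) (\<lambda>i. of_int i * laurent_coeff b i) i) summable_on UNIV"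
      by (intro summable_on_add abs_summable_summable[OF convolution_abs_summable] a' b' sa sb)
    then show "(\<lambda>i. of_int i * convolution (laurent_coeff a) (laurent_coeff b) i) abs_summable_on UNIV"
      unfolding convolution_leibniz[OF sa sb a'(2) b'(2)]
      by (simp only: summable_on_iff_abs_summable_on_complex)
  qed
qed

section \<open>Matrices with summable entries\<close>

lemma F_class_iff: "M \<in> F_class \<longleftrightarrow> case_prod M abs_summable_on UNIV"
  by (simp add: F_class_def case_prod_unfold)

lemma F_norm_alt: "F_norm M = (\<Sum>\<^sub>\<infinity>p. norm (case_prod M p))"
  by (simp add: F_norm_def case_prod_unfold)

lemma F_add:
  assumes M: "M \<in> F_class" and N: "N \<in> F_class"
  shows "mat_add M N \<in> F_class" and "F_norm (mat_add M N) \<le> F_norm M + F_norm N"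
proof -
  have S: "(\<lambda>p. norm (case_prod M p) + norm (case_prod N p)) summable_on UNIV"
    using M N by (intro summable_on_add) (simp_all only: F_class_iff)
  have le: "norm (case_prod (mat_add M N) p) \<le> norm (case_prod M p) + norm (case_prod N p)" for p
    by (simp add: mat_add_def case_prod_unfold norm_triangle_ineq)
  have *: "case_prod (mat_add M N) abs_summable_on UNIV"
    by (rule summable_on_comparison_test[OF S]) (auto simp only: le norm_ge_zero)
  then show "mat_add M N \<in> F_class" by (simp only: F_class_iff)
  have "F_norm (mat_add M N) \<le> (\<Sum>\<^sub>\<infinity>p. norm (case_prod M p) + norm (case_prod N p))"
    unfolding F_norm_alt by (rule infsum_mono[OF * S]) (rule le)
  also have "\<dots> = F_norm M + F_norm N"
    unfolding F_norm_alt by (rule infsum_add) (use M N in \<open>simp_all only: F_class_iff\<close>)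
  finally show "F_norm (mat_add M N) \<le> F_norm M + F_norm N" .
qed

lemma F_uminus:
  "(\<lambda>i j. - M i j) \<in> F_class \<longleftrightarrow> M \<in> F_class" "F_norm (\<lambda>i j. - M i j) = F_norm M"
  by (simp_all add: F_class_def F_norm_def)

definition mat_prod :: "inf_matrix \<Rightarrow> inf_matrix \<Rightarrow> inf_matrix" where
  "mat_prod M N i j = (\<Sum>\<^sub>\<infinity>k. M i k * N k j)"

text \<open>
  The form of \<open>reindexed_product\<close> for matrices whose entries may repeat: \<open>\<alpha>\<close> and \<open>\<beta>\<close> name
  the entry of the sequence \<open>f\<close> or \<open>g\<close> that stands at a given position. What is required is that
  the two names together determine row, column and summation index.
\<close>

lemma mat_prod_reindexed:
  fixes f :: "'x \<Rightarrow> complex" and g :: "'y \<Rightarrow> complex"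
  assumes f: "f abs_summable_on UNIV" and g: "g abs_summable_on UNIV"
    and M: "\<And>i k. M i k = f (\<alpha> i k)" and N: "\<And>k j. N k j = g (\<beta> k j)"
    and inj: "inj (\<lambda>((i, j), k). (\<alpha> i k, \<beta> k j))"
  shows "is_mat_prod M N (mat_prod M N)" and "mat_prod M N \<in> F_class"
    and "F_norm (mat_prod M N) \<le> (\<Sum>\<^sub>\<infinity>x. norm (f x)) * (\<Sum>\<^sub>\<infinity>y. norm (g y))"
proof -
  have "inj (\<lambda>(p, k). (\<alpha> (fst p) k, \<beta> k (snd p)))"
    using inj by (simp add: case_prod_unfold)
  note R = reindexed_product[OF f g this]
  have e: "case_prod (mat_prod M N) = (\<lambda>p. \<Sum>\<^sub>\<infinity>k. f (\<alpha> (fst p) k) * g (\<beta> k (snd p)))"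
    by (simp add: mat_prod_def M N case_prod_unfold)
  show "is_mat_prod M N (mat_prod M N)"
    unfolding is_mat_prod_def mat_prod_def M N
    using abs_summable_summable[OF R(1)[of "(i, j)" for i j]] by simp
  show "mat_prod M N \<in> F_class" unfolding F_class_iff e by (rule R(2))
  show "F_norm (mat_prod M N) \<le> (\<Sum>\<^sub>\<infinity>x. norm (f x)) * (\<Sum>\<^sub>\<infinity>y. norm (g y))"
    unfolding F_norm_alt e by (rule R(3))
qed

lemma F_mat_prod:
  assumes "M \<in> F_class" and "N \<in> F_class"
  shows "is_mat_prod M N (mat_prod M N)" and "mat_prod M N \<in> F_class"
    and "F_norm (mat_prod M N) \<le> F_norm M * F_norm N"
  using mat_prod_reindexed[of "case_prod M" "case_prod N" M Pair N Pair] assms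
  unfolding F_class_iff F_norm_alt by (auto simp: inj_def)

lemma toeplitz_F_mat_prod:
  assumes "laurent_coeff a abs_summable_on UNIV" and "N \<in> F_class"
  shows "is_mat_prod (toeplitz a) N (mat_prod (toeplitz a) N)"
    and "mat_prod (toeplitz a) N \<in> F_class"
    and "F_norm (mat_prod (toeplitz a) N) \<le> wiener_norm a * F_norm N"
  using mat_prod_reindexed[of "laurent_coeff a" "case_prod N" "toeplitz a"
      "\<lambda>i k. int k - int i" N Pair] assms
  unfolding F_class_iff F_norm_alt wiener_norm_def toeplitz_def by (auto simp: inj_def)

lemma F_toeplitz_mat_prod:
  assumes "M \<in> F_class" and "laurent_coeff b abs_summable_on UNIV"
  shows "is_mat_prod M (toeplitz b) (mat_prod M (toeplitz b))"
    and "mat_prod M (toeplitz b) \<in> F_class"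
    and "F_norm (mat_prod M (toeplitz b)) \<le> F_norm M * wiener_norm b"
  using mat_prod_reindexed[of "case_prod M" "laurent_coeff b" M Pair "toeplitz b"
      "\<lambda>k j. int j - int k"] assms
  unfolding F_class_iff F_norm_alt wiener_norm_def toeplitz_def by (auto simp: inj_def)

section \<open>The product of two Toeplitz matrices\<close>

text \<open>
  The coefficient with index \<open>n\<close> fills the \<open>n\<close> entries with \<open>i + j + 1 = n\<close>, hence the weight
  \<open>n\<close>.
\<close>

lemma hankel_F_class:
  assumes "(\<lambda>n. of_nat n * fps_nth u n) abs_summable_on UNIV"
  shows "hankel u \<in> F_class"
proof -
  \<comment> \<open>An entry is located by its antidiagonal and its row.\<close>
  define h where "h = (\<lambda>(i, j). (i + j + 1, i :: nat))"
  have "(\<lambda>n. \<Sum>\<^sub>\<infinity>i\<in>{..<n}. norm (fps_nth u n)) abs_summable_on UNIV"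
    using assms by (simp add: norm_mult)
  then have "(\<lambda>(n, i). fps_nth u n) abs_summable_on (SIGMA n:UNIV. {..<n})"
    unfolding Infinite_Sum.abs_summable_on_Sigma_iff by simp
  then have "(\<lambda>p. norm (fps_nth u (fst p))) summable_on range h"
    unfolding case_prod_unfold by (rule summable_on_subset_banach) (auto simp: h_def)
  moreover have "inj h" by (auto simp: inj_def h_def)
  ultimately have "(\<lambda>p. norm (fps_nth u (fst (h p)))) summable_on UNIV"
    by (simp add: summable_on_reindex o_def)
  then show ?thesis
    by (simp add: F_class_def hankel_def h_def case_prod_unfold)
qed

lemma hankel_parts_F_class:
  assumes "a \<in> wiener1"
  shows "hankel (plus_part a) \<in> F_class" and "hankel (minus_part a) \<in> F_class"
proof -
  have w: "(\<lambda>i. norm (of_int i * laurent_coeff a i)) summable_on UNIV"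
    by (rule wiener1_weighted_summable[OF assms])
  have "(\<lambda>i. norm (of_int i * laurent_coeff a i)) summable_on range int"
    by (rule summable_on_subset_banach[OF w]) simp
  then have "(\<lambda>n. norm (of_nat n * laurent_coeff a (int n))) summable_on UNIV"
    by (simp add: summable_on_reindex o_def)
  moreover have "of_nat n * fps_nth (plus_part a) n = of_nat n * laurent_coeff a (int n)" for n
    by (simp add: plus_part_def)
  ultimately show "hankel (plus_part a) \<in> F_class"
    by (intro hankel_F_class) (simp only:)
  have "(\<lambda>i. norm (of_int i * laurent_coeff a i)) summable_on range (\<lambda>n. - int n)"
    by (rule summable_on_subset_banach[OF w]) simp
  then have "(\<lambda>n. norm (of_nat n * laurent_coeff a (- int n))) summable_on UNIV"
    by (subst (asm) summable_on_reindex) (auto simp: inj_def o_def norm_mult)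
  moreover have "of_nat n * fps_nth (minus_part a) n = of_nat n * laurent_coeff a (- int n)" for n
    by (simp add: minus_part_def)
  ultimately show "hankel (minus_part a) \<in> F_class"
    by (intro hankel_F_class) (simp only:)
qed

text \<open>
  The summation index of a matrix product is a natural number, whereas the convolution runs over
  all integers; the negative half of the convolution is the Hankel product.
\<close>

lemma toeplitz_mult:
  assumes s: "laurent_coeff a abs_summable_on UNIV" and t: "laurent_coeff b abs_summable_on UNIV"
    and c: "laurent_coeff c = convolution (laurent_coeff a) (laurent_coeff b)"
    and H: "is_mat_prod (hankel (minus_part a)) (hankel (plus_part b)) H"
  shows "is_mat_prod (toeplitz a) (toeplitz b) (\<lambda>i j. toeplitz c i j - H i j)"
  unfolding is_mat_prod_def
proof (intro allI)
  fix i j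
  define P where "P l = laurent_coeff a (l - int i) * laurent_coeff b (int j - l)" for l
  \<comment> \<open>Shifted by \<open>i\<close>, the full series for the coefficient with index \<open>j - i\<close>.\<close>
  have bij: "bij (\<lambda>l. l - int i)"
    by (rule bij_betw_byWitness[where f' = "\<lambda>l. l + int i"]) auto
  have "((\<lambda>k. laurent_coeff a k * laurent_coeff b (int j - int i - k)) has_sum toeplitz c i j) UNIV"
    unfolding toeplitz_def c convolution_def
    by (rule has_sum_infsum[OF convolution_terms_summable[OF s t]])
  then have all: "(P has_sum toeplitz c i j) UNIV"
    using has_sum_reindex_bij_betw[OF bij,
        of "\<lambda>k. laurent_coeff a k * laurent_coeff b (int j - int i - k)"]
    by (simp add: P_def[abs_def])
  \<comment> \<open>The negative indices are reflected onto the natural numbers.\<close>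
  have "P (- int k - 1) = hankel (minus_part a) i k * hankel (plus_part b) k j" for k
  proof -
    have idx: "- int k - 1 - int i = - int (i + k + 1)" "int j - (- int k - 1) = int (k + j + 1)"
      by simp_all
    show ?thesis
      unfolding P_def idx by (simp add: hankel_def minus_part_def plus_part_def)
  qed
  then have "((P \<circ> (\<lambda>k. - int k - 1)) has_sum H i j) UNIV"
    using H by (simp add: is_mat_prod_def o_def)
  then have neg: "(P has_sum H i j) (range (\<lambda>k. - int k - 1))"
    by (subst has_sum_reindex) (auto simp: inj_def)
  have "l \<in> range (\<lambda>k. - int k - 1) \<longleftrightarrow> l < 0" for l
    by (auto simp: image_iff intro: exI[of _ "nat (- l - 1)"])
  then have "UNIV - range (\<lambda>k. - int k - 1) = range int"
    by (auto simp: image_iff intro: exI[of _ "nat _"]) (metis int_nat_eq not_less)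
  then have "(P has_sum (toeplitz c i j - H i j)) (range int)"
    using has_sum_Diff[OF all neg] by simp
  then show "((\<lambda>k. toeplitz a i k * toeplitz b k j) has_sum (toeplitz c i j - H i j)) UNIV"
    by (simp add: has_sum_reindex o_def P_def toeplitz_def)
qed

section \<open>The product of two perturbed Toeplitz matrices\<close>

lemma is_mat_prod_mat_add:
  assumes "is_mat_prod A B C" "is_mat_prod A B' D" "is_mat_prod A' B C'" "is_mat_prod A' B' D'"
  shows "is_mat_prod (mat_add A A') (mat_add B B') (mat_add (mat_add C D) (mat_add C' D'))"
  unfolding is_mat_prod_def
proof (intro allI)
  fix i j
  have "((\<lambda>k. (A i k * B k j + A i k * B' k j) + (A' i k * B k j + A' i k * B' k j)) has_sum
          ((C i j + D i j) + (C' i j + D' i j))) UNIV"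
    using assms by (intro has_sum_add) (auto simp: is_mat_prod_def)
  then show "((\<lambda>k. mat_add A A' i k * mat_add B B' k j) has_sum
               mat_add (mat_add C D) (mat_add C' D') i j) UNIV"
    by (simp add: mat_add_def algebra_simps)
qed

theorem theorem3p6:
  fixes a b c :: "complex \<Rightarrow> complex" and A B E\<^sub>a E\<^sub>b :: inf_matrix
  assumes "a \<in> wiener1" and "b \<in> wiener1"
    and "E\<^sub>a \<in> F_class" and "E\<^sub>b \<in> F_class"
    and "A = mat_add (toeplitz a) E\<^sub>a" and "B = mat_add (toeplitz b) E\<^sub>b"
    and "\<And>z. z \<in> unit_circle \<Longrightarrow> c z = a z * b z"
  shows "\<exists>C E\<^sub>c. is_mat_prod A B C \<and> C \<in> CQT \<and>
           C = mat_add (toeplitz c) E\<^sub>c \<and> c \<in> wiener1 \<and> E\<^sub>c \<in> F_class \<and>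
           F_norm E\<^sub>c \<le> F_norm (hankel (minus_part a)) * F_norm (hankel (plus_part b))
             + wiener_norm a * F_norm E\<^sub>b + wiener_norm b * F_norm E\<^sub>a
             + F_norm E\<^sub>a * F_norm E\<^sub>b"
proof -
  have s: "laurent_coeff a abs_summable_on UNIV" and t: "laurent_coeff b abs_summable_on UNIV"
    using wiener1_weighted_summable(1)[OF assms(1)] wiener1_weighted_summable(1)[OF assms(2)]
    by (auto simp: wiener_expansion_def)
  note c = wiener1_mult[OF assms(1,2,7)]
  define H where "H = mat_prod (hankel (minus_part a)) (hankel (plus_part b))"
  note H = F_mat_prod[OF hankel_parts_F_class(2)[OF assms(1)] hankel_parts_F_class(1)[OF assms(2)],
      folded H_def]
  define X where "X = mat_prod (toeplitz a) E\<^sub>b"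
  note X = toeplitz_F_mat_prod[OF s assms(4), folded X_def]
  define Y where "Y = mat_prod E\<^sub>a (toeplitz b)"
  note Y = F_toeplitz_mat_prod[OF assms(3) t, folded Y_def]
  define Z where "Z = mat_prod E\<^sub>a E\<^sub>b"
  note Z = F_mat_prod[OF assms(3,4), folded Z_def]
  \<comment> \<open>The Hankel product enters with a minus sign, which the norm does not see.\<close>
  define H' where "H' = (\<lambda>i j. - H i j)"
  have H': "H' \<in> F_class" "F_norm H' = F_norm H"
    using H(2) by (simp_all add: H'_def F_uminus)
  define E where "E = mat_add (mat_add H' X) (mat_add Y Z)"
  note HX = F_add[OF H'(1) X(2)] and YZ = F_add[OF Y(2) Z(2)]
  note E = F_add[OF HX(1) YZ(1), folded E_def]
  have "is_mat_prod A B
          (mat_add (mat_add (\<lambda>i j. toeplitz c i j - H i j) X) (mat_add Y Z))"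
    unfolding assms(5,6)
    by (rule is_mat_prod_mat_add[OF toeplitz_mult[OF s t c(2) H(1)] X(1) Y(1) Z(1)])
  also have "mat_add (mat_add (\<lambda>i j. toeplitz c i j - H i j) X) (mat_add Y Z)
               = mat_add (toeplitz c) E"
    by (simp add: mat_add_def E_def H'_def algebra_simps)
  finally have "is_mat_prod A B (mat_add (toeplitz c) E)" .
  moreover have "F_norm E \<le> F_norm (hankel (minus_part a)) * F_norm (hankel (plus_part b))
             + wiener_norm a * F_norm E\<^sub>b + wiener_norm b * F_norm E\<^sub>a
             + F_norm E\<^sub>a * F_norm E\<^sub>b"
    using E(2) HX(2) YZ(2) H'(2) H(3) X(3) Y(3) Z(3) by (simp add: mult.commute)
  ultimately show ?thesis
    using c(1) E(1) by (auto simp: CQT_def)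
qed

end
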